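(* Let $(\mathcal{N},\mathcal{L})$ be the graph of a connected network with shunt set $\mathcal{T}$. Suppose that: (i) the branches are not mutually coupled and every branch has nonzero series admittance, so that $\mathbf{Y}_{\mathcal{L}}=\mathrm{diag}(\mathbf{y}_{\mathcal{L}})$ is a diagonal full-rank matrix; (ii) every branch $l\in\mathcal{L}$ has nodal admittance matrix $\mathbf{a}_l\,y_l\,\mathbf{a}_l^H$ with $\mathbf{a}_l$ as described in the context (nonzero complex tap ratio $a_l$). Let $\mathbf{Y}_{\mathcal{N}}=\mathbf{A}_{\mathcal{L},\mathcal{N}}^H\mathbf{Y}_{\mathcal{L}}\mathbf{A}_{\mathcal{L},\mathcal{N}}+\mathbf{Y}_{\mathcal{T}}$ be the admittance matrix of the network, and suppose that $\mathrm{Null}(\mathbf{Y}_{\mathcal{N}})\subseteq\mathrm{Null}(\mathbf{A}_{\mathcal{L},\mathcal{N}})$. Then $$\mathrm{rank}(\mathbf{Y}_{\mathcal{N}})=\begin{cases}\mathrm{rank}(\mathbf{A}_{\mathcal{L},\mathcal{N}}) & \text{if }\mathcal{T}=\emptyset,\\ |\mathcal{N}| & \text{otherwise.}\end{cases}$$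
   Context: A network consists of a finite nonempty set $\mathcal{N}$ of nodes (the ground node is not included), a finite set $\mathcal{L}$ of branches, and a finite set $\mathcal{T}$ of shunts. Each branch $l\in\mathcal{L}$ goes from a node $i$ to a different node $k$ and carries a series admittance $y_l\in\mathbb{C}$ and a tap ratio $a_l\in\mathbb{C}\setminus\{0\}$. Its vector $\mathbf{a}_l\in\mathbb{C}^{|\mathcal{N}|}$ has $i$-th entry $1$, $k$-th entry $-a_l^*$ (complex conjugate of $-a_l$), and all other entries zero; the admittance matrix of this branch alone is $\mathbf{Y}_l=\mathbf{a}_l y_l\mathbf{a}_l^H\in\mathbb{C}^{|\mathcal{N}|\times|\mathcal{N}|}$. Several branches may join the same two nodes, but there are no parallel branches with the same tap ratio (such branches are merged by adding admittances). Each shunt is attached to one node (connecting it to ground), has nonzero complex admittance, and there is at most one shunt per node (parallel shunts are merged). $\mathbf{A}_{\mathcal{L},\mathcal{N}}\in\mathbb{C}^{|\mathcal{L}|\times|\mathcal{N}|}$ is the generalized incidence matrix, whose $l$-th row is $\mathbf{a}_l^H$ (entries $1$ at $i$ and $-a_l$ at $k$). $\mathbf{Y}_{\mathcal{L}}=\mathrm{diag}(\mathbf{y}_{\mathcal{L}})$ is the diagonal matrix of series admittances $y_l$. $\mathbf{Y}_{\mathcal{T}}=\mathrm{diag}(\mathbf{y}_{\mathcal{T}})\in\mathbb{C}^{|\mathcal{N}|\times|\mathcal{N}|}$ is the diagonal matrix whose $n$-th diagonal entry is the admittance of the shunt at node $n$ (zero if there is none). The network is connected if the graph $(\mathcal{N},\mathcal{L})$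 is connected (ground and shunts are not used for connectivity). $(\cdot)^H$ is the conjugate transpose and $\mathrm{Null}(\cdot)$ the null space over $\mathbb{C}$. *)

theory Defs
  imports
    "Jordan_Normal_Form.DL_Rank"
    "Jordan_Normal_Form.Matrix_Kernel"
    "Jordan_Normal_Form.Schur_Decomposition"
    "Graph_Theory.Digraph_Component"
begin

text \<open>
  Nodes and branches are numbered, so that they index the rows and columns of matrices: the nodes
  are \<open>{..<node_count}\<close> (ground is not among them) and the branches \<open>{..<branch_count}\<close>. There may
  be no branches at all (a network with a single node). Since there is at most one shunt per node, a
  shunt is identified with the node it is attached to; \<open>shunt_admittance\<close> is meaningful only on
  \<open>shunts\<close>, and the branch fields only below \<open>branch_count\<close>.
\<close>

record network_data =
  node_count :: nat
  branch_count :: nat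
  from_node :: "nat \<Rightarrow> nat"
  to_node :: "nat \<Rightarrow> nat"
  series_admittance :: "nat \<Rightarrow> complex"
  tap_ratio :: "nat \<Rightarrow> complex"
  shunts :: "nat set"
  shunt_admittance :: "nat \<Rightarrow> complex"

text \<open>
  A tap ratio refers to the orientation of its branch, so the condition \<open>no_parallel\<close> compares only
  branches with the same orientation.
\<close>

locale network =
  fixes N :: network_data
  assumes nodes_nonempty: "node_count N > 0"
    and from_node: "l < branch_count N \<Longrightarrow> from_node N l < node_count N"
    and to_node: "l < branch_count N \<Longrightarrow> to_node N l < node_count N"
    and from_neq_to: "l < branch_count N \<Longrightarrow> from_node N l \<noteq> to_node N l"
    and tap_ratio_nonzero: "l < branch_count N \<Longrightarrow> tap_ratio N l \<noteq> 0"
    and no_parallel: "\<lbrakk>l < branch_count N; l' < branch_count N; from_node N l = from_node N l';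
      to_node N l = to_node N l'; tap_ratio N l = tap_ratio N l'\<rbrakk> \<Longrightarrow> l = l'"
    and shunts: "shunts N \<subseteq> {..<node_count N}"
    and shunt_admittance_nonzero: "t \<in> shunts N \<Longrightarrow> shunt_admittance N t \<noteq> 0"

definition network_graph :: "network_data \<Rightarrow> (nat, nat) pre_digraph" where
  "network_graph N = \<lparr>verts = {..<node_count N}, arcs = {..<branch_count N},
     tail = from_node N, head = to_node N\<rparr>"

text \<open>Connectivity disregards the orientation of the branches.\<close>

definition connected_network :: "network_data \<Rightarrow> bool" where
  "connected_network N \<longleftrightarrow> network N \<and> Digraph_Component.connected (network_graph N)"

definition branch_vec :: "network_data \<Rightarrow> nat \<Rightarrow> complex vec" where
  "branch_vec N l = vec (node_count N)
     (\<lambda>i. if i = from_node N l then 1 else if i = to_node N l then - cnj (tap_ratio N l) else 0)"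

definition branch_admittance :: "network_data \<Rightarrow> nat \<Rightarrow> complex mat" where
  "branch_admittance N l =
     (let a = mat_of_cols (node_count N) [branch_vec N l]
      in series_admittance N l \<cdot>\<^sub>m (a * mat_adjoint a))"

definition incidence_mat :: "network_data \<Rightarrow> complex mat" where
  "incidence_mat N =
     mat_of_rows (node_count N) (map (\<lambda>l. conjugate (branch_vec N l)) [0..<branch_count N])"

definition series_admittance_mat :: "network_data \<Rightarrow> complex mat" where
  "series_admittance_mat N = mat_diag (branch_count N) (series_admittance N)"

definition shunt_admittance_mat :: "network_data \<Rightarrow> complex mat" where
  "shunt_admittance_mat N =
     mat_diag (node_count N) (\<lambda>i. if i \<in> shunts N then shunt_admittance N i else 0)"

definition admittance_mat :: "network_data \<Rightarrow> complex mat" where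
  "admittance_mat N =
     mat_adjoint (incidence_mat N) * series_admittance_mat N * incidence_mat N
       + shunt_admittance_mat N"

text \<open>The branch part of the admittance matrix is the sum of the matrices of the single branches.\<close>

lemma mat_adjoint_index:
  assumes "i < dim_col A" "j < dim_row A"
  shows "mat_adjoint A $$ (i, j) = conjugate (A $$ (j, i))"
  using assms by (simp add: mat_adjoint_def mat_of_rows_def)

lemma dim_mat_adjoint [simp]:
  "dim_row (mat_adjoint A) = dim_col A" "dim_col (mat_adjoint A) = dim_row A"
  by (simp_all add: mat_adjoint_def)

lemma branch_part_index:
  assumes i: "i < node_count N" and j: "j < node_count N"
  shows "(mat_adjoint (incidence_mat N) * series_admittance_mat N * incidence_mat N) $$ (i, j)
    = (\<Sum>l<branch_count N. branch_admittance N l $$ (i, j))"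
proof -
  let ?n = "node_count N" and ?m = "branch_count N"
  have dims [simp]: "dim_row (incidence_mat N) = ?m" "dim_col (incidence_mat N) = ?n"
    by (simp_all add: incidence_mat_def)
  have vdim [simp]: "dim_vec (branch_vec N l) = ?n" for l
    by (simp add: branch_vec_def)
  have inc: "incidence_mat N $$ (l, k) = cnj (branch_vec N l $ k)" if "l < ?m" "k < ?n" for l k
    using that by (simp add: incidence_mat_def mat_of_rows_def)
  have left: "(mat_adjoint (incidence_mat N) * series_admittance_mat N) $$ (i, l)
      = branch_vec N l $ i * series_admittance N l" if "l < ?m" for l
    unfolding series_admittance_mat_def
    by (subst mat_diag_mult_right[of _ ?n])
       (use i that in \<open>auto simp: mat_adjoint_index inc\<close>)
  have sdim [simp]: "dim_row (series_admittance_mat N) = ?m" "dim_col (series_admittance_mat N) = ?m"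
    by (simp_all add: series_admittance_mat_def mat_diag_def)
  have br: "branch_admittance N l $$ (i, j)
      = series_admittance N l * (branch_vec N l $ i * cnj (branch_vec N l $ j))" for l
    using i j by (simp add: branch_admittance_def Let_def scalar_prod_def mat_adjoint_index
      mat_of_cols_def)
  show ?thesis
    using i j by (subst index_mult_mat)
      (auto simp: scalar_prod_def left inc br atLeast0LessThan simp del: index_mult_mat(1)
        intro!: sum.cong)
qed

end

theory Submission
  imports Defs
begin

text \<open>
  The matrix \<open>mat_adjoint A * D * A\<close> of the branches vanishes on the kernel of the incidence matrix
  \<open>A\<close>. Without shunts the two kernels therefore agree, and so do the ranks by rank-nullity. With a
  shunt, a vector \<open>v\<close> in the kernel of the admittance matrix lies in the kernel of \<open>A\<close>, so only the
  shunt part remains and forces \<open>v\<close> to vanish at each shunt node. Being in the kernel of \<open>A\<close> means that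
  the two end values of each branch differ by a nonzero factor, its tap ratio, so the zero spreads to all nodes
  by connectivity.
\<close>

text \<open>Rank-nullity for the linear map \<open>v \<mapsto> A *\<^sub>v v\<close>: its image is
  the column space of \<open>A\<close>, whose dimension is the rank, and its kernel is
  \<open>mat_kernel A\<close>.\<close>

lemma rank_plus_kernel_dim:
  fixes A :: "'a :: field mat"
  assumes A: "A \<in> carrier_mat nr nc"
  shows "vec_space.rank nr A + kernel_dim A = nc"
proof -
  interpret V: vec_space "TYPE('a)" nc .
  interpret W: vec_space "TYPE('a)" nr .
  interpret kernel nr nc A
    by unfold_locales (rule A)
  interpret L: linear_map class_ring "module_vec TYPE('a) nc" "module_vec TYPE('a) nr"
      "\<lambda>v. A *\<^sub>v v"
  proof (intro linear_map.intro mod_hom.intro mod_hom_axioms.intro)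
    show "(\<lambda>v. A *\<^sub>v v) \<in> LinearCombinations.module_hom class_ring
        (module_vec TYPE('a) nc) (module_vec TYPE('a) nr)"
      using A by (simp add: LinearCombinations.module_hom_def module_vec_simps
        mult_add_distrib_mat_vec[OF A] mult_mat_vec[OF A])
  qed (rule V.vectorspace_axioms W.vectorspace_axioms V.module_axioms W.module_axioms)+
  have "L.imT = W.col_space A"
    using A by (auto simp: L.im_def W.col_space_eq[OF A] module_vec_simps)
  moreover have "L.kerT = mat_kernel A"
    using A by (auto simp: L.ker_def mat_kernel_def module_vec_simps)
  ultimately show ?thesis
    using L.rank_nullity[OF V.fin_dim] by (simp add: W.rank_def W.col_space_def V.dim_is_n)
qed

text \<open>By rank-nullity the rank is determined by the kernel and the number of columns. The row
  counts may differ, as they do for the admittance and the incidence matrix.\<close>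

lemma rank_eq_if_mat_kernel_eq:
  fixes A B :: "'a :: field mat"
  assumes "A \<in> carrier_mat nr nc" "B \<in> carrier_mat mr nc" "mat_kernel A = mat_kernel B"
  shows "vec_space.rank nr A = vec_space.rank mr B"
proof -
  have "kernel_dim A = kernel_dim B"
    using assms by (simp add: kernel_dim_def)
  then show ?thesis
    using rank_plus_kernel_dim[OF assms(1)] rank_plus_kernel_dim[OF assms(2)] by simp
qed

text \<open>A square matrix with determinant zero would have a nonzero kernel vector.\<close>

lemma full_rank_if_mat_kernel_trivial:
  fixes A :: "'a :: field mat"
  assumes A: "A \<in> carrier_mat n n" and "mat_kernel A \<subseteq> {0\<^sub>v n}"
  shows "vec_space.rank n A = n"
proof -
  have "det A \<noteq> 0"
    using assms(2) mat_kernelI[OF A] by (auto simp: det_0_iff_vec_prod_zero_field[OF A])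
  then show ?thesis
    using vec_space.det_rank_iff[OF A] by simp
qed

lemma incidence_mat_carrier: "incidence_mat N \<in> carrier_mat (branch_count N) (node_count N)"
  by (simp add: incidence_mat_def mat_of_rows_def)

lemma admittance_mat_carrier: "admittance_mat N \<in> carrier_mat (node_count N) (node_count N)"
  by (simp add: admittance_mat_def shunt_admittance_mat_def mat_diag_def)

lemma branch_vec_carrier: "branch_vec N l \<in> carrier_vec (node_count N)"
  by (simp add: branch_vec_def)

text \<open>This is entry \<open>l\<close> of \<open>A v = 0\<close>: row \<open>l\<close> is the
  conjugate of \<open>branch_vec N l\<close>, so its only nonzero entries are 1 and minus the tap
  ratio itself.\<close>

lemma (in network) mat_kernel_incidence_branch:
  assumes v: "v \<in> mat_kernel (incidence_mat N)" and l: "l < branch_count N"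
  shows "v $ from_node N l = tap_ratio N l * v $ to_node N l"
proof -
  let ?n = "node_count N" and ?i = "from_node N l" and ?k = "to_node N l"
  have dim: "dim_vec v = ?n" and Av: "incidence_mat N *\<^sub>v v = 0\<^sub>v (branch_count N)"
    using mat_kernelD[OF incidence_mat_carrier v] by auto
  note ends = from_node[OF l] to_node[OF l] from_neq_to[OF l]
  have row: "row (incidence_mat N) l = conjugate (branch_vec N l)"
    using l by (simp add: incidence_mat_def branch_vec_carrier)
  have "0 = (incidence_mat N *\<^sub>v v) $ l"
    using l by (simp add: Av)
  also have "\<dots> = conjugate (branch_vec N l) \<bullet> v"
    using l incidence_mat_carrier[of N] by (simp add: row)
  also have "\<dots> = (\<Sum>j<?n. cnj (branch_vec N l $ j) * v $ j)"
    using branch_vec_carrier[of N l] by (simp add: scalar_prod_def dim atLeast0LessThan)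
  \<comment> \<open>The nested conditional splits into two separate indicators because the ends of
    the branch are distinct.\<close>
  also have "\<dots> = (\<Sum>j<?n. (if j = ?i then v $ j else 0)
      + (if j = ?k then - tap_ratio N l * v $ j else 0))"
    using ends(3) by (intro sum.cong) (auto simp: branch_vec_def)
  also have "\<dots> = v $ ?i - tap_ratio N l * v $ ?k"
    using ends by (simp add: sum.distrib)
  finally show ?thesis
    by simp
qed

lemma mat_kernel_incidence_eq_0:
  assumes "connected_network N" and v: "v \<in> mat_kernel (incidence_mat N)"
    and t: "t < node_count N" "v $ t = 0"
  shows "v = 0\<^sub>v (node_count N)"
proof -
  interpret network N
    using assms(1) by (simp add: connected_network_def)
  \<comment> \<open>In the symmetric closure a walk from \<open>t\<close> may cross a branch in
    either direction.\<close>
  let ?G = "mk_symmetric (network_graph N)"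
  have reach: "(t, u) \<in> rtrancl_on {..<node_count N} (parcs ?G)" if "u < node_count N" for u
    using assms(1) t that
    by (auto simp: connected_network_def connected_def strongly_connected_def reachable_def
      network_graph_def)
  have zero: "v $ u = 0" if "u < node_count N" for u
    using reach[OF that]
  proof (induction rule: rtrancl_on_induct)
    case (step u w)
    from \<open>(u, w) \<in> parcs ?G\<close> obtain l where "l < branch_count N"
      and "(u, w) = (from_node N l, to_node N l) \<or> (u, w) = (to_node N l, from_node N l)"
      by (auto simp: parcs_mk_symmetric network_graph_def)
    \<comment> \<open>A zero at the \<open>to\<close> end gives one at the \<open>from\<close> end
      directly; the converse divides by the tap ratio.\<close>
    then show ?case
      using mat_kernel_incidence_branch[OF v] tap_ratio_nonzero step.IH by fastforce
  qed (rule t)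
  then show ?thesis
    using mat_kernelD[OF incidence_mat_carrier v] by (intro eq_vecI) auto
qed

text \<open>Reassociating the branch part makes \<open>A v\<close> its innermost factor, and this is
  zero.\<close>

lemma admittance_mult_vec:
  assumes v: "v \<in> mat_kernel (incidence_mat N)"
  shows "admittance_mat N *\<^sub>v v = shunt_admittance_mat N *\<^sub>v v"
proof -
  let ?n = "node_count N" and ?m = "branch_count N"
  let ?A = "incidence_mat N" and ?D = "series_admittance_mat N" and ?T = "shunt_admittance_mat N"
  have A: "?A \<in> carrier_mat ?m ?n"
    by (rule incidence_mat_carrier)
  have B: "mat_adjoint ?A * ?D \<in> carrier_mat ?n ?m"
    using A by (intro carrier_matI) (simp_all add: series_admittance_mat_def mat_diag_def)
  have T: "?T \<in> carrier_mat ?n ?n"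
    by (simp add: shunt_admittance_mat_def mat_diag_def)
  have v': "v \<in> carrier_vec ?n" "?A *\<^sub>v v = 0\<^sub>v ?m"
    using mat_kernelD[OF A v] by auto
  have zero: "mat_adjoint ?A * ?D *\<^sub>v 0\<^sub>v ?m = 0\<^sub>v ?n"
    using B by (intro eq_vecI) (auto simp del: index_mult_mat)
  have "admittance_mat N *\<^sub>v v = mat_adjoint ?A * ?D *\<^sub>v (?A *\<^sub>v v) + ?T *\<^sub>v v"
    unfolding admittance_mat_def
    using A B T v' by (simp add: add_mult_distrib_mat_vec[of _ ?n ?n] assoc_mult_mat_vec[OF B A])
  also have "\<dots> = 0\<^sub>v ?n + ?T *\<^sub>v v"
    using v'(2) zero by simp
  finally show ?thesis
    using T v' by simp
qed

lemma shunt_admittance_mult_vec_index: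
  assumes "v \<in> carrier_vec (node_count N)" and i: "i < node_count N"
  shows "(shunt_admittance_mat N *\<^sub>v v) $ i =
    (if i \<in> shunts N then shunt_admittance N i * v $ i else 0)"
proof -
  have "(shunt_admittance_mat N *\<^sub>v v) $ i =
      (\<Sum>j<node_count N. shunt_admittance_mat N $$ (i, j) * v $ j)"
    using assms by (simp add: shunt_admittance_mat_def mat_diag_def scalar_prod_def atLeast0LessThan)
  also have "\<dots> = (\<Sum>j<node_count N.
      if j = i then (if i \<in> shunts N then shunt_admittance N i * v $ i else 0) else 0)"
    using i by (intro sum.cong) (auto simp: shunt_admittance_mat_def mat_diag_def)
  finally show ?thesis
    using i by simp
qed

theorem theorem1:
  fixes N :: network_data
  assumes "connected_network N"
    and "\<And>l. l < branch_count N \<Longrightarrow> series_admittance N l \<noteq> 0"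
    and "mat_kernel (admittance_mat N) \<subseteq> mat_kernel (incidence_mat N)"
  shows "vec_space.rank (node_count N) (admittance_mat N) =
    (if shunts N = {} then vec_space.rank (branch_count N) (incidence_mat N) else node_count N)"
proof (cases "shunts N = {}")
  case True
  \<comment> \<open>The reverse inclusion is the hypothesis on the kernels, so this one makes them
    equal.\<close>
  have "mat_kernel (incidence_mat N) \<subseteq> mat_kernel (admittance_mat N)"
  proof
    fix v
    assume v: "v \<in> mat_kernel (incidence_mat N)"
    note vc = mat_kernelD(1)[OF incidence_mat_carrier v]
    have "shunt_admittance_mat N *\<^sub>v v = 0\<^sub>v (node_count N)"
      using shunt_admittance_mult_vec_index[OF vc] True
      by (intro eq_vecI) (auto simp: shunt_admittance_mat_def mat_diag_def)
    then show "v \<in> mat_kernel (admittance_mat N)"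
      using admittance_mult_vec[OF v] by (intro mat_kernelI[OF admittance_mat_carrier vc]) simp
  qed
  then show ?thesis
    using True assms(3) rank_eq_if_mat_kernel_eq[OF admittance_mat_carrier incidence_mat_carrier]
    by auto
next
  case False
  then obtain t where t: "t \<in> shunts N"
    by blast
  interpret network N
    using assms(1) by (simp add: connected_network_def)
  have tn: "t < node_count N"
    using t shunts by auto
  have "mat_kernel (admittance_mat N) \<subseteq> {0\<^sub>v (node_count N)}"
  proof
    fix v
    assume v: "v \<in> mat_kernel (admittance_mat N)"
    then have vA: "v \<in> mat_kernel (incidence_mat N)"
      using assms(3) by blast
    have "shunt_admittance_mat N *\<^sub>v v = 0\<^sub>v (node_count N)"
      using mat_kernelD(2)[OF admittance_mat_carrier v] admittance_mult_vec[OF vA] by simp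
    \<comment> \<open>Entry \<open>t\<close> of the shunt product is \<open>v $ t\<close> times a
      nonzero shunt admittance.\<close>
    then have "v $ t = 0"
      using shunt_admittance_mult_vec_index[OF mat_kernelD(1)[OF incidence_mat_carrier vA] tn]
        t tn shunt_admittance_nonzero by simp
    then show "v \<in> {0\<^sub>v (node_count N)}"
      using mat_kernel_incidence_eq_0[OF assms(1) vA tn] by simp
  qed
  then show ?thesis
    using False full_rank_if_mat_kernel_trivial[OF admittance_mat_carrier] by simp
qed

end
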